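(* Let $f,g\in\mathbb{C}[X,Y]$ be polynomials with $\det\operatorname{Jac}(f,g)=1$ such that $(f,g):\mathbb{C}^2\to\mathbb{C}^2$ is not a polynomial automorphism, and suppose that $$g=X^{n_1}Y^{n_2}+\text{t.l.d.},\qquad f=c_1X^{m_1}Y^{m_2}+\text{t.l.d.},$$ with integers $n_1,n_2,m_1,m_2>0$ and $c_1\in\mathbb{C}^*$. Put $n=n_1+n_2$, $m=m_1+m_2$, $k=\gcd(n_1,n_2)$, and assume $\frac{m_1}{n_1}=\frac{m_2}{n_2}$ and $m\neq n$. Let $g^{1/k}=X^{n_1/k}Y^{n_2/k}(1+w)\in\mathbb{C}\mathbb{L}_\infty^{X,Y}$ ($\deg w<0$) be the $k$-th root of $g$ with leading coefficient $1$. Assume further that there is a Laurent polynomial $W(T)\in\mathbb{C}[T,T^{-1}]$ such that: (1) $n_1\ne n_2$ (and hence $|m_1-m_2|\neq|n_1-n_2|$); (2) $k>1$ and $f-W(g^{1/k})=dX^{1-n_1}Y^{1-n_2}+\text{t.l.d.}$ for some $d\in\mathbb{C}^*$; (3) for some $k$-th root of unity $\varepsilon_0$, $f-W(\varepsilon_0 g^{1/k})=eX^{n_1'}Y^{n_2'}+\text{t.l.d.}$ with $e\in\mathbb{C}^*$, $n_1',n_2'\in\mathbb{Z}$, $n_1'+n_2'>2-n$. Let $V=\{(x,y)\in\mathbb{K}^2: \delta\le|x|=|y|\le\varrho\}$ with real numbers $1<\delta\le\varrho$, let $(x_0,y_0)\in V$, and put $r:=|x_0|=|y_0|$, $\alpha_0:=f(x_0,y_0)$,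 $\widetilde\beta_0:=g^{1/k}(x_0,y_0)$, and $T_{r,r}:=\{(x,y)\in\mathbb{K}^2:|x|=|y|=r\}$. Let $\varepsilon\in\mathbb{C}$ be a primitive $k$-th root of unity. Then there exists $i\in\{1,\dots,k-1\}$ for which the system $$\begin{cases} f(X,Y)=\alpha_0\\ \varepsilon^i g^{1/k}(X,Y)=\widetilde\beta_0\end{cases}$$ has no solutions in $T_{r,r}$.
   Context: $\mathbb{C}\mathbb{L}_\infty^{X,Y}$ is the $\mathbb{C}$-algebra of formal Laurent series at infinity in two variables: formal sums $\sum_{i=-\infty}^{N}f_i$, $N\in\mathbb{Z}$, where each $f_i\in\mathbb{C}[X,X^{-1},Y,Y^{-1}]$ is a Laurent polynomial that is zero or homogeneous of degree $i$. The degree of a nonzero element is the largest $i$ with $f_i\neq0$. "$+\,$t.l.d." (terms of lower degrees) means "plus an element of $\mathbb{C}\mathbb{L}_\infty^{X,Y}$ (or of $\mathbb{C}[X,Y]$, for polynomials) of degree strictly less than the degree of the displayed monomial". Writing $g=X^{n_1}Y^{n_2}(1+u)$ with $u\in\mathbb{C}\mathbb{L}_\infty^{X,Y}$, $\deg u<0$, the root is defined by $g^{1/k}:=X^{n_1/k}Y^{n_2/k}\sum_{j\ge0}\binom{1/k}{j}u^j$; it is invertible in $\mathbb{C}\mathbb{L}_\infty^{X,Y}$, so Laurent polynomials may be evaluated at it. $\mathbb{K}$ is the completion of an algebraic closure of $\mathbb{C}((t^{-1}))$ with respect to the non-archimedean absolute value extending $|\varphi|=e^{\deg\varphi}$ on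 $\mathbb{C}((t^{-1}))$, where $\deg$ is the degree in $t$ (so $|a|=1$ for $a\in\mathbb{C}^*$ and $|t|=e$). Elements of $\mathbb{C}\mathbb{L}_\infty^{X,Y}$ are evaluated at points $(x,y)\in\mathbb{K}^2$ with $|x|=|y|>1$ by $\sum_i f_i(x,y)$, which converges in $\mathbb{K}$; in this way $f$, $g$, $g^{1/k}$, $f-W(g^{1/k})$ are regarded as functions on $V$ and on $T_{r,r}$. *)

theory Defs
  imports
    "HOL-Analysis.Analysis"
    "HOL-Computational_Algebra.Computational_Algebra"
    "HOL-Algebra.Algebraic_Closure_Type"
    "HOL-Library.Poly_Mapping"
    "HOL-Library.Product_Plus"
begin

section \<open>Polynomials in two variables\<close>

text \<open>
  An element of \<open>\<complex>[X,Y]\<close> is a \<open>complex poly poly\<close>; the outer variable is \<open>Y\<close> and the inner one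
  is \<open>X\<close>, so the coefficient of \<open>X\<^sup>i Y\<^sup>j\<close> in \<open>p\<close> is \<open>poly.coeff (poly.coeff p j) i\<close>.
\<close>

definition poly2 :: "complex poly poly \<Rightarrow> complex \<Rightarrow> complex \<Rightarrow> complex"
  where "poly2 p x y = poly (poly p [:y:]) x"

definition pderiv_X :: "complex poly poly \<Rightarrow> complex poly poly"
  where "pderiv_X p = map_poly pderiv p"

definition pderiv_Y :: "complex poly poly \<Rightarrow> complex poly poly"
  where "pderiv_Y p = pderiv p"

definition jacobian_det :: "complex poly poly \<Rightarrow> complex poly poly \<Rightarrow> complex poly poly"
  where "jacobian_det f g = pderiv_X f * pderiv_Y g - pderiv_Y f * pderiv_X g"

definition polynomial_automorphism :: "complex poly poly \<Rightarrow> complex poly poly \<Rightarrow> bool"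
  where "polynomial_automorphism f g \<longleftrightarrow>
    (\<exists>p q. \<forall>x y.
      poly2 p (poly2 f x y) (poly2 g x y) = x \<and> poly2 q (poly2 f x y) (poly2 g x y) = y \<and>
      poly2 f (poly2 p x y) (poly2 q x y) = x \<and> poly2 g (poly2 p x y) (poly2 q x y) = y)"


section \<open>Formal Laurent series at infinity in two variables\<close>

text \<open>
  Laurent polynomials in \<open>X, Y\<close>: the coefficient of \<open>X\<^sup>a Y\<^sup>b\<close> in \<open>p\<close> is \<open>Poly_Mapping.lookup p (a, b)\<close>.
\<close>

type_synonym lpoly2 = "(int \<times> int) \<Rightarrow>\<^sub>0 complex"

definition homogeneous :: "int \<Rightarrow> lpoly2 \<Rightarrow> bool"
  where "homogeneous i p \<longleftrightarrow> (\<forall>(a, b) \<in> Poly_Mapping.keys p. a + b = i)"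

text \<open>
  The formal sum of the homogeneous components \<open>f\<^sub>i\<close>, \<open>i \<le> N\<close>, is encoded as the Laurent series
  \<open>\<Sum>\<^sub>i f\<^sub>i s\<^bsup>-i\<^esup>\<close> in an auxiliary variable \<open>s\<close> over the ring of Laurent polynomials: the \<open>n\<close>-th
  coefficient is \<open>f\<^bsub>-n\<^esub>\<close>. The series whose \<open>n\<close>-th coefficient is homogeneous of degree \<open>-n\<close> form
  a subring, and the ring operations of \<open>fls\<close> are those of the formal sums.
\<close>

type_synonym series_inf = "lpoly2 fls"

definition CL_inf :: "series_inf set"
  where "CL_inf = {F. \<forall>n. homogeneous (- n) (fls_nth F n)}"

text \<open>The degree of a nonzero element.\<close>

definition deg_inf :: "series_inf \<Rightarrow> int"
  where "deg_inf F = - fls_subdegree F"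

text \<open>The term \<open>c X\<^sup>a Y\<^sup>b\<close>; it sits at the exponent \<open>- (a + b)\<close> of \<open>s\<close>.\<close>

definition monom_inf :: "complex \<Rightarrow> int \<Rightarrow> int \<Rightarrow> series_inf"
  where "monom_inf c a b = fls_shift (a + b) (fls_const (Poly_Mapping.single (a, b) c))"

abbreviation const_inf :: "complex \<Rightarrow> series_inf"
  where "const_inf c \<equiv> monom_inf c 0 0"

definition of_poly2 :: "complex poly poly \<Rightarrow> series_inf"
  where "of_poly2 p =
    (\<Sum>j\<le>Polynomial.degree p. \<Sum>i\<le>Polynomial.degree (poly.coeff p j).
       monom_inf (poly.coeff (poly.coeff p j) i) (int i) (int j))"

text \<open>\<open>F = c X\<^sup>a Y\<^sup>b +\<close> terms of lower degrees. If \<open>F\<close> and \<open>c X\<^sup>a Y\<^sup>b\<close> are polynomials, so is \<open>R\<close>.\<close>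

definition leading_tld :: "series_inf \<Rightarrow> complex \<Rightarrow> int \<Rightarrow> int \<Rightarrow> bool"
  where "leading_tld F c a b \<longleftrightarrow>
    (\<exists>R \<in> CL_inf. F = monom_inf c a b + R \<and> (R = 0 \<or> deg_inf R < a + b))"

text \<open>
  For \<open>G = X\<^sup>a Y\<^sup>b (1 + u)\<close> with \<open>deg u < 0\<close> and \<open>k\<close> dividing \<open>a\<close> and \<open>b\<close>, the series \<open>u\<close> has only
  positive powers of \<open>s\<close>, so \<open>\<Sum>\<^sub>j (1/k gchoose j) u\<^sup>j\<close> is a composition of formal power series.
\<close>

definition root_inf :: "nat \<Rightarrow> int \<Rightarrow> int \<Rightarrow> series_inf \<Rightarrow> series_inf"
  where "root_inf k a b G =
    (let u = monom_inf 1 (- a) (- b) * G - 1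
     in monom_inf 1 (a div int k) (b div int k) *
        fps_to_fls (fps_compose
          (Abs_fps (\<lambda>j. Poly_Mapping.single 0 ((1 / of_nat k) gchoose j))) (fls_regpart u)))"

text \<open>
  Integer powers of a unit, and the value at a unit \<open>H\<close> of a Laurent polynomial in one variable,
  where the coefficient of \<open>T\<^sup>i\<close> in \<open>W\<close> is \<open>Poly_Mapping.lookup W i\<close>.
\<close>

definition powi_inf :: "series_inf \<Rightarrow> int \<Rightarrow> series_inf"
  where "powi_inf H i = (if i \<ge> 0 then H ^ nat i else (THE H'. H * H' = 1) ^ nat (- i))"

definition lpoly_subst :: "(int \<Rightarrow>\<^sub>0 complex) \<Rightarrow> series_inf \<Rightarrow> series_inf"
  where "lpoly_subst W H =
    (\<Sum>i\<in>Poly_Mapping.keys W. const_inf (Poly_Mapping.lookup W i) * powi_inf H i)"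


section \<open>The field \<open>\<bbbK>\<close> and evaluation\<close>

text \<open>
  \<open>\<complex>((t\<^sup>-\<^sup>1))\<close> is \<open>complex fls\<close> with \<open>fls_X\<close> in the role of \<open>t\<^sup>-\<^sup>1\<close>, so that the degree in \<open>t\<close> is
  \<open>- fls_subdegree\<close>. No completion of its algebraic closure is available as a type, so a completion
  is a complete field \<open>'k\<close> together with an embedding \<open>\<iota>\<close> of the algebraic closure onto a dense
  subfield. The metric of \<open>'k\<close> is that of the absolute value \<open>absval\<close>.
\<close>

definition absval :: "'k::{zero,metric_space} \<Rightarrow> real"
  where "absval x = dist x 0"

locale completed_alg_closure =
  fixes \<iota> :: "complex fls alg_closure \<Rightarrow> 'k::{field,complete_space}"
  assumes hom_one: "\<iota> 1 = 1"
    and hom_add: "\<iota> (a + b) = \<iota> a + \<iota> b"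
    and hom_mult: "\<iota> (a * b) = \<iota> a * \<iota> b"
    and dist_absval: "dist x y = absval (x - y :: 'k)"
    and absval_mult: "absval (x * y :: 'k) = absval x * absval y"
    and absval_add: "absval (x + y :: 'k) \<le> max (absval x) (absval y)"
    and absval_fls: "\<phi> \<noteq> 0 \<Longrightarrow> absval (\<iota> (to_ac \<phi>)) = exp (of_int (- fls_subdegree \<phi>))"
    and dense: "closure (range \<iota>) = UNIV"

definition of_complex_K :: "(complex fls alg_closure \<Rightarrow> 'k) \<Rightarrow> complex \<Rightarrow> 'k"
  where "of_complex_K \<iota> c = \<iota> (to_ac (fls_const c))"

definition eval_lpoly2 ::
    "(complex fls alg_closure \<Rightarrow> 'k::field) \<Rightarrow> lpoly2 \<Rightarrow> 'k \<Rightarrow> 'k \<Rightarrow> 'k"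
  where "eval_lpoly2 \<iota> p x y =
    (\<Sum>(a, b)\<in>Poly_Mapping.keys p.
       of_complex_K \<iota> (Poly_Mapping.lookup p (a, b)) * x powi a * y powi b)"

text \<open>The summation runs from the top degree \<open>deg_inf F\<close> of \<open>F\<close> downwards.\<close>

definition eval_inf ::
    "(complex fls alg_closure \<Rightarrow> 'k::{field,complete_space}) \<Rightarrow> series_inf \<Rightarrow> 'k \<Rightarrow> 'k \<Rightarrow> 'k"
  where "eval_inf \<iota> F x y =
    suminf (\<lambda>n. eval_lpoly2 \<iota> (fls_nth F (fls_subdegree F + int n)) x y)"

definition primitive_root_of_unity :: "nat \<Rightarrow> complex \<Rightarrow> bool"
  where "primitive_root_of_unity k z \<longleftrightarrow> z ^ k = 1 \<and> (\<forall>j. 0 < j \<and> j < k \<longrightarrow> z ^ j \<noteq> 1)"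

end

theory Submission
  imports Defs
begin

text \<open>
  At a point with \<open>|x| = |y| = r > 1\<close> evaluation is a ring homomorphism on
  \<open>\<complex>L\<^sub>\<infinity>\<close>, and by the ultrametric inequality a series \<open>c X\<^sup>a Y\<^sup>b + t.l.d.\<close> takes a value of
  absolute value \<open>r\<^bsup>a+b\<^esup>\<close>. Choose \<open>i\<close> with \<open>\<epsilon>\<^sup>i = \<epsilon>0\<close>; it is nonzero, since the differences
  \<open>f - W(h)\<close> and \<open>f - W(\<epsilon>0 h)\<close> have different degrees. At the base point the first difference
  has the value \<open>\<alpha>0 - W(\<beta>0)\<close>, and at a solution of the \<open>i\<close>-th system the second one has the same
  value. Comparing absolute values gives \<open>r\<^bsup>2-n\<^esup> = r\<^bsup>n1'+n2'\<^esup>\<close>, which contradicts \<open>n1' + n2' > 2 - n\<close>.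
\<close>

section \<open>Units and roots in the ring of Laurent series at infinity\<close>

lemma homogeneous_0 [simp]: "homogeneous i 0"
  by (simp add: homogeneous_def)

lemma homogeneous_single: "a + b = i \<Longrightarrow> homogeneous i (Poly_Mapping.single (a, b) c)"
  by (simp add: homogeneous_def)

lemma homogeneous_1: "homogeneous 0 1"
  using homogeneous_single[of 0 0 0 1] by (simp add: zero_prod_def flip: single_one)

lemma homogeneous_add: "homogeneous i p \<Longrightarrow> homogeneous i q \<Longrightarrow> homogeneous i (p + q)"
  unfolding homogeneous_def using keys_add[of p q] by blast

lemma homogeneous_uminus: "homogeneous i p \<Longrightarrow> homogeneous i (- p)"
  unfolding homogeneous_def by simp

lemma homogeneous_sum: "(\<And>a. a \<in> A \<Longrightarrow> homogeneous i (f a)) \<Longrightarrow> homogeneous i (sum f A)"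
  by (induction A rule: infinite_finite_induct) (auto intro: homogeneous_add)

lemma homogeneous_mult:
  assumes "homogeneous i p" "homogeneous j q"
  shows "homogeneous (i + j) (p * q)"
proof -
  have "a + b = i + j" if "(a, b) \<in> Poly_Mapping.keys (p * q)" for a b
    using that keys_mult[of p q] assms unfolding homogeneous_def by fastforce
  then show ?thesis unfolding homogeneous_def by blast
qed

lemma CL_inf_nth: "F \<in> CL_inf \<Longrightarrow> homogeneous (- n) (fls_nth F n)"
  by (simp add: CL_inf_def)

lemma CL_inf_0 [simp]: "0 \<in> CL_inf"
  by (simp add: CL_inf_def)

lemma CL_inf_monom [simp]: "monom_inf c a b \<in> CL_inf"
  by (auto simp: CL_inf_def monom_inf_def intro: homogeneous_single)

lemma const_inf_1: "const_inf 1 = 1"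
  by (simp add: monom_inf_def fls_const_1 flip: zero_prod_def single_one)

lemma CL_inf_1 [simp]: "1 \<in> CL_inf"
  using CL_inf_monom[of 1 0 0] by (simp only: const_inf_1)

lemma CL_inf_add: "F \<in> CL_inf \<Longrightarrow> G \<in> CL_inf \<Longrightarrow> F + G \<in> CL_inf"
  by (simp add: CL_inf_def homogeneous_add)

lemma CL_inf_uminus: "F \<in> CL_inf \<Longrightarrow> - F \<in> CL_inf"
  by (simp add: CL_inf_def homogeneous_uminus)

lemma CL_inf_diff: "F \<in> CL_inf \<Longrightarrow> G \<in> CL_inf \<Longrightarrow> F - G \<in> CL_inf"
  using CL_inf_add[of F "- G"] CL_inf_uminus[of G] by simp

lemma CL_inf_sum: "(\<And>a. a \<in> A \<Longrightarrow> f a \<in> CL_inf) \<Longrightarrow> sum f A \<in> CL_inf"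
  by (induction A rule: infinite_finite_induct) (auto intro: CL_inf_add)

lemma CL_inf_mult:
  assumes "F \<in> CL_inf" "G \<in> CL_inf"
  shows "F * G \<in> CL_inf"
  unfolding CL_inf_def
proof (clarify, unfold fls_times_nth(2), rule homogeneous_sum)
  fix n i
  show "homogeneous (- n) (fls_nth F i * fls_nth G (n - i))"
    using homogeneous_mult[OF CL_inf_nth[OF assms(1), of i] CL_inf_nth[OF assms(2), of "n - i"]]
    by simp
qed

lemma CL_inf_power: "F \<in> CL_inf \<Longrightarrow> F ^ n \<in> CL_inf"
  by (induction n) (auto intro: CL_inf_mult)

lemma CL_inf_of_poly2: "of_poly2 p \<in> CL_inf"
  unfolding of_poly2_def by (intro CL_inf_sum CL_inf_monom)

lemma monom_inf_mult: "monom_inf c a b * monom_inf c' a' b' = monom_inf (c * c') (a + a') (b + b')"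
  by (simp add: monom_inf_def fls_shifted_times_simps fls_const_mult_const mult_single
      algebra_simps flip: fls_times_both_shifted_simp)

lemma monom_inf_times_nth:
  "fls_nth (monom_inf c a b * F) n = Poly_Mapping.single (a, b) c * fls_nth F (n + a + b)"
  by (simp add: monom_inf_def fls_shifted_times_simps algebra_simps)

section \<open>Power series in \<open>s\<close> with homogeneous coefficients\<close>

lemma CL_inf_fps_iff: "fps_to_fls P \<in> CL_inf \<longleftrightarrow> (\<forall>n. homogeneous (- int n) (fps_nth P n))"
proof
  assume *: "\<forall>n. homogeneous (- int n) (fps_nth P n)"
  have "homogeneous (- n) (fls_nth (fps_to_fls P) n)" for n
    using *[rule_format, of "nat n"] by (cases "n < 0") auto
  then show "fps_to_fls P \<in> CL_inf" by (simp add: CL_inf_def)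
next
  assume *: "fps_to_fls P \<in> CL_inf"
  show "\<forall>n. homogeneous (- int n) (fps_nth P n)"
  proof
    fix n
    show "homogeneous (- int n) (fps_nth P n)"
      using CL_inf_nth[OF *, of "int n"] by simp
  qed
qed

text \<open>The coefficient of \<open>v ^ i\<close> at \<open>n\<close> has degree
  \<open>- n\<close>, and a factor of degree 0 does not change that. The intended \<open>A\<close>
  is the binomial series, whose coefficients are constants.\<close>

lemma CL_inf_fps_compose:
  assumes A: "\<And>j. homogeneous 0 (fps_nth A j)" and u: "fps_to_fls v \<in> CL_inf"
  shows "fps_to_fls (fps_compose A v) \<in> CL_inf"
proof -
  have "homogeneous (- int n) (fps_nth (fps_compose A v) n)" for n
    unfolding fps_compose_nth
  proof (rule homogeneous_sum)
    fix i
    have "homogeneous (- int n) (fps_nth (v ^ i) n)"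
      using CL_inf_nth[OF CL_inf_power[OF u, of i], of "int n"] by (simp flip: fps_to_fls_power)
    from homogeneous_mult[OF A this]
    show "homogeneous (- int n) (fps_nth A i * fps_nth (v ^ i) n)" by simp
  qed
  then show ?thesis by (simp add: CL_inf_fps_iff)
qed

text \<open>The inverse has coefficients given by \<open>q 0 = 1\<close> and
  \<open>q n = - (\<Sum>i=1..n. P i * q (n - i))\<close>. Each summand has degree
  \<open>- i - (n - i) = - n\<close>, so homogeneity follows by strong induction.\<close>

lemma CL_inf_obtain_inverse:
  assumes P: "fps_to_fls P \<in> CL_inf" "fps_nth P 0 = 1"
  obtains Q where "Q \<in> CL_inf" "fps_to_fls P * Q = 1"
proof
  let ?q = "fps_right_inverse_constructor P 1"
  have hom: "homogeneous (- int n) (?q n)" for n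
  proof (induction n rule: less_induct)
    case (less n)
    show ?case
    proof (cases "n = 0")
      case False
      have "homogeneous (- int n) (fps_nth P i * ?q (n - i))" if "i \<in> {1..n}" for i
      proof -
        have "homogeneous (- int i) (fps_nth P i)"
          using CL_inf_nth[OF P(1), of "int i"] by simp
        moreover have "homogeneous (- int (n - i)) (?q (n - i))"
          using less[of "n - i"] that by simp
        ultimately show ?thesis
          using homogeneous_mult that by (fastforce simp: of_nat_diff)
      qed
      then show ?thesis
        using False
        by (simp only: fps_right_inverse_constructor_rec neq0_conv mult_minus1) (intro homogeneous_uminus homogeneous_sum; simp)
    qed (simp add: homogeneous_1)
  qed
  show "fps_to_fls (fps_right_inverse P 1) \<in> CL_inf"
    using hom by (simp add: CL_inf_fps_iff)
  show "fps_to_fls P * fps_to_fls (fps_right_inverse P 1) = 1"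
    using fps_right_inverse[of P 1] P(2) by (simp flip: fls_times_fps_to_fls)
qed

text \<open>Vanishing coefficients express the degree bound without a case split on
  \<open>R = 0\<close>. The signs flip because degree \<open>i\<close> sits at the exponent
  \<open>- i\<close> of \<open>s\<close>.\<close>

lemma leading_tldE:
  assumes "leading_tld F c a b"
  obtains R where "R \<in> CL_inf" "F = monom_inf c a b + R" "\<And>n. n \<le> - (a + b) \<Longrightarrow> fls_nth R n = 0"
proof -
  from assms obtain R where R: "R \<in> CL_inf" "F = monom_inf c a b + R" "R = 0 \<or> deg_inf R < a + b"
    unfolding leading_tld_def by blast
  have "fls_nth R n = 0" if "n \<le> - (a + b)" for n
    using R(3) that by (auto simp: deg_inf_def intro: fls_eq0_below_subdegree)
  with R show thesis using that by blast
qed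

text \<open>\<open>powi_inf\<close> picks its inverse in the whole ring of Laurent series over
  \<open>lpoly2\<close>. An explicit inverse \<open>H'\<close> inside \<open>CL_inf\<close> keeps
  the negative powers there too, where evaluation is well behaved.\<close>

definition inverses_in_CL_inf :: "series_inf \<Rightarrow> series_inf \<Rightarrow> bool"
  where "inverses_in_CL_inf H H' \<longleftrightarrow> H \<in> CL_inf \<and> H' \<in> CL_inf \<and> H * H' = 1"

text \<open>The root is a monomial times a power series in \<open>s\<close> with constant
  coefficient 1, and both factors have inverses in \<open>CL_inf\<close>.\<close>

lemma root_inf_unit:
  assumes "leading_tld G 1 a b"
  obtains H' where "inverses_in_CL_inf (root_inf k a b G) H'"
proof -
  obtain R where R: "R \<in> CL_inf" "G = monom_inf 1 a b + R" "\<And>n. n \<le> - (a + b) \<Longrightarrow> fls_nth R n = 0"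
    using leading_tldE[OF assms] by blast
  define u where "u = monom_inf 1 (- a) (- b) * G - 1"
  have u: "u = monom_inf 1 (- a) (- b) * R"
    by (simp add: u_def R(2) distrib_left monom_inf_mult const_inf_1)
  have u0: "fls_nth u n = 0" if "n \<le> 0" for n
    using that by (simp add: u monom_inf_times_nth R(3))
  \<comment> \<open>Only positive powers of \<open>s\<close> occur in \<open>u\<close>, so passing
    to the regular part in \<open>root_inf\<close> loses nothing.\<close>
  have reg: "fps_to_fls (fls_regpart u) = u"
    by (rule fls_eqI) (simp add: u0)
  have uC: "u \<in> CL_inf"
    unfolding u by (intro CL_inf_mult R CL_inf_monom)
  define A :: "lpoly2 fps" where
    "A = Abs_fps (\<lambda>j. Poly_Mapping.single 0 ((1 / of_nat k) gchoose j))"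
  define P where "P = fps_compose A (fls_regpart u)"
  have PC: "fps_to_fls P \<in> CL_inf"
    unfolding P_def
    by (rule CL_inf_fps_compose) (auto simp: A_def zero_prod_def reg uC intro: homogeneous_single)
  have P0: "fps_nth P 0 = 1"
    by (simp add: P_def A_def fps_compose_nth)
  obtain Q where Q: "Q \<in> CL_inf" "fps_to_fls P * Q = 1"
    using CL_inf_obtain_inverse[OF PC P0] by blast
  let ?a = "a div int k" and ?b = "b div int k"
  have root: "root_inf k a b G = monom_inf 1 ?a ?b * fps_to_fls P"
    by (simp add: root_inf_def Let_def u_def P_def A_def)
  have "root_inf k a b G * (monom_inf 1 (- ?a) (- ?b) * Q) =
      (monom_inf 1 ?a ?b * monom_inf 1 (- ?a) (- ?b)) * (fps_to_fls P * Q)"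
    unfolding root by (simp add: mult_ac)
  also have "\<dots> = 1"
    by (simp add: Q monom_inf_mult const_inf_1)
  finally show thesis
    using that[of "monom_inf 1 (- ?a) (- ?b) * Q"] PC Q
    by (simp add: inverses_in_CL_inf_def root CL_inf_mult)
qed

lemma inverses_const_mult:
  assumes "inverses_in_CL_inf H H'" "c \<noteq> 0"
  shows "inverses_in_CL_inf (const_inf c * H) (const_inf (1 / c) * H')"
proof -
  have "(const_inf c * H) * (const_inf (1 / c) * H') = (const_inf c * const_inf (1 / c)) * (H * H')"
    by (simp add: mult_ac)
  with assms show ?thesis
    by (simp add: inverses_in_CL_inf_def CL_inf_mult monom_inf_mult const_inf_1)
qed

text \<open>Inverses in a commutative ring are unique, so the definite description in
  \<open>powi_inf\<close> denotes \<open>H'\<close>.\<close>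

lemma powi_inf_inverses:
  assumes "inverses_in_CL_inf H H'"
  shows "powi_inf H i = (if i \<ge> 0 then H ^ nat i else H' ^ nat (- i))"
proof -
  have "(THE H'. H * H' = 1) = H'"
  proof (rule the_equality)
    fix G assume "H * G = 1"
    then have "H' = H' * (H * G)" by simp
    also have "\<dots> = (H * H') * G" by (simp add: mult_ac)
    finally show "G = H'" using assms by (simp add: inverses_in_CL_inf_def)
  qed (use assms in \<open>simp add: inverses_in_CL_inf_def\<close>)
  then show ?thesis by (simp add: powi_inf_def)
qed

lemma CL_inf_powi:
  assumes "inverses_in_CL_inf H H'"
  shows "powi_inf H i \<in> CL_inf"
  using assms by (simp add: powi_inf_inverses[OF assms] inverses_in_CL_inf_def CL_inf_power)

lemma CL_inf_lpoly_subst: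
  assumes "inverses_in_CL_inf H H'"
  shows "lpoly_subst W H \<in> CL_inf"
  unfolding lpoly_subst_def
  by (intro CL_inf_sum CL_inf_mult CL_inf_monom CL_inf_powi[OF assms])

text \<open>The powers of \<open>z\<close> with exponents below \<open>k\<close> are distinct, so
  they exhaust the \<open>k\<close> complex solutions of \<open>w ^ k = 1\<close>.\<close>

lemma primitive_root_generates:
  assumes "primitive_root_of_unity k z" "0 < k" "w ^ k = 1"
  shows "\<exists>i<k. z ^ i = w"
proof -
  have z: "z ^ k = 1" "\<And>j. 0 < j \<Longrightarrow> j < k \<Longrightarrow> z ^ j \<noteq> 1"
    using assms(1) by (auto simp: primitive_root_of_unity_def)
  have "z \<noteq> 0" using z(1) assms(2) by (auto simp: power_0_left)
  have less: "z ^ i \<noteq> z ^ j" if "i < j" "j < k" for i j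
  proof
    assume "z ^ i = z ^ j"
    also have "z ^ j = z ^ i * z ^ (j - i)" using that by (simp flip: power_add)
    finally have "z ^ (j - i) = 1" using \<open>z \<noteq> 0\<close> by simp
    then show False using z(2)[of "j - i"] that by simp
  qed
  have "inj_on (\<lambda>i. z ^ i) {..<k}"
    by (intro linorder_inj_onI less) auto
  then have card: "card ((\<lambda>i. z ^ i) ` {..<k}) = k"
    by (simp add: card_image)
  have "(z ^ i) ^ k = 1" for i
    using z(1) by (metis mult.commute power_mult power_one)
  then have "(\<lambda>i. z ^ i) ` {..<k} \<subseteq> {w. w ^ k = 1}"
    by blast
  moreover have "finite {w :: complex. w ^ k = 1}"
    using finite_roots_unity[of k] assms(2) by simp
  ultimately have "(\<lambda>i. z ^ i) ` {..<k} = {w. w ^ k = 1}"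
    using card card_roots_unity_eq[OF assms(2)] by (simp add: card_subset_eq)
  then have "w \<in> (\<lambda>i. z ^ i) ` {..<k}"
    using assms(3) by simp
  then show ?thesis by blast
qed

section \<open>The absolute value\<close>

context completed_alg_closure
begin

section \<open>Consequences of the ultrametric inequality\<close>

lemma absval_nonneg: "0 \<le> absval (x :: 'k)"
  by (simp add: absval_def)

lemma absval_0 [simp]: "absval (0 :: 'k) = 0"
  by (simp add: absval_def)

lemma absval_eq_0_iff [simp]: "absval (x :: 'k) = 0 \<longleftrightarrow> x = 0"
  by (simp add: absval_def)

lemma absval_1 [simp]: "absval (1 :: 'k) = 1"
  using absval_mult[of 1 1] absval_eq_0_iff[of 1] by simp

lemma absval_minus [simp]: "absval (- x :: 'k) = absval x"
proof -
  have "absval (- 1 :: 'k) ^ 2 = 1"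
    using absval_mult[of "- 1" "- 1"] by (simp add: power2_eq_square)
  then have "absval (- 1 :: 'k) = 1"
    using absval_nonneg[of "- 1"] by (simp add: power2_eq_1_iff)
  then show ?thesis using absval_mult[of "- 1" x] by simp
qed

lemma absval_diff: "absval (x - y :: 'k) \<le> max (absval x) (absval y)"
  using absval_add[of x "- y"] by simp

text \<open>Since \<open>x = (x + y) - y\<close> and \<open>y\<close> is strictly smaller than
  \<open>x\<close>, the maximum bounding \<open>absval x\<close> must be
  \<open>absval (x + y)\<close>.\<close>

lemma absval_add_eq_left:
  assumes "absval (y :: 'k) < absval x"
  shows "absval (x + y) = absval x"
  using absval_add[of x y] absval_diff[of "x + y" y] assms by auto

text \<open>The bound does not grow with the number of summands; \<open>0 \<le> B\<close> covers the
  empty sum.\<close>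

lemma absval_sum_le:
  assumes "0 \<le> B" "\<And>i. i \<in> A \<Longrightarrow> absval (f i :: 'k) \<le> B"
  shows "absval (sum f A) \<le> B"
  using assms(2)
proof (induction A rule: infinite_finite_induct)
  case (insert a A)
  then have "absval (f a) \<le> B" "absval (sum f A) \<le> B" by auto
  then show ?case using absval_add[of "f a" "sum f A"] insert.hyps by simp
qed (use assms(1) in auto)

lemma absval_power: "absval (x ^ n :: 'k) = absval x ^ n"
  by (induction n) (auto simp: absval_mult)

lemma absval_inverse: "absval (inverse x :: 'k) = inverse (absval x)"
proof (cases "x = 0")
  case False
  then have "absval x * absval (inverse x) = 1"
    by (simp flip: absval_mult)
  then show ?thesis by (metis inverse_unique)
qed auto

lemma absval_powi: "absval (x powi i :: 'k) = absval x powi i"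
  by (simp add: power_int_def absval_power absval_inverse)

text \<open>The type classes of \<open>'k\<close> do not link its metric to its field operations;
  continuity comes from \<open>dist_absval\<close> and the ultrametric inequality.\<close>

lemma tendsto_add_absval:
  assumes "u \<longlonglongrightarrow> (a :: 'k)" "v \<longlonglongrightarrow> b"
  shows "(\<lambda>n. u n + v n) \<longlonglongrightarrow> a + b"
proof -
  have lim: "(\<lambda>n. dist (u n) a + dist (v n) b) \<longlonglongrightarrow> 0"
    using assms by (auto intro!: tendsto_eq_intros dest: tendsto_dist_iff[THEN iffD1])
  have le: "dist (u n + v n) (a + b) \<le> dist (u n) a + dist (v n) b" for n
  proof -
    have "u n + v n - (a + b) = (u n - a) + (v n - b)" by simp
    then have "dist (u n + v n) (a + b) \<le> max (absval (u n - a)) (absval (v n - b))"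
      using absval_add[of "u n - a" "v n - b"] by (simp only: dist_absval)
    also have "\<dots> \<le> dist (u n) a + dist (v n) b"
      by (simp add: dist_absval absval_nonneg)
    finally show ?thesis .
  qed
  show ?thesis
    by (rule tendsto_dist_iff[THEN iffD2], rule tendsto_sandwich[OF _ _ tendsto_const lim])
      (intro always_eventually allI zero_le_dist le)+
qed

lemma tendsto_mult_absval:
  assumes "u \<longlonglongrightarrow> (a :: 'k)" "v \<longlonglongrightarrow> b"
  shows "(\<lambda>n. u n * v n) \<longlonglongrightarrow> a * b"
proof -
  \<comment> \<open>This bound comes from \<open>u v - a b = u (v - b) + (u - a) b\<close>.\<close>
  let ?B = "\<lambda>n. absval (u n) * dist (v n) b + dist (u n) a * absval b"
  have "(\<lambda>n. absval (u n)) \<longlonglongrightarrow> absval a"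
    unfolding absval_def using assms by (intro tendsto_intros)
  moreover have "(\<lambda>n. dist (u n) a) \<longlonglongrightarrow> 0" "(\<lambda>n. dist (v n) b) \<longlonglongrightarrow> 0"
    using assms by (auto dest: tendsto_dist_iff[THEN iffD1])
  ultimately have "?B \<longlonglongrightarrow> absval a * 0 + 0 * absval b"
    by (intro tendsto_intros)
  then have lim: "?B \<longlonglongrightarrow> 0" by simp
  have le: "dist (u n * v n) (a * b) \<le> ?B n" for n
  proof -
    have "u n * v n - a * b = u n * (v n - b) + (u n - a) * b" by (simp add: algebra_simps)
    then have "dist (u n * v n) (a * b) \<le> max (absval (u n) * dist (v n) b) (dist (u n) a * absval b)"
      using absval_add[of "u n * (v n - b)" "(u n - a) * b"] by (simp add: dist_absval absval_mult)
    also have "\<dots> \<le> ?B n" by (simp add: absval_nonneg)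
    finally show ?thesis .
  qed
  show ?thesis
    by (rule tendsto_dist_iff[THEN iffD2], rule tendsto_sandwich[OF _ _ tendsto_const lim])
      (intro always_eventually allI zero_le_dist le)+
qed

lemma absval_limit_le:
  assumes "u \<longlonglongrightarrow> (a :: 'k)" "\<And>n. absval (u n) \<le> B"
  shows "absval a \<le> B"
proof -
  have "(\<lambda>n. absval (u n)) \<longlonglongrightarrow> absval a"
    unfolding absval_def using assms by (intro tendsto_intros)
  then show ?thesis using assms(2) by (intro LIMSEQ_le_const2) auto
qed

section \<open>Complex constants in the complete field\<close>

abbreviation cK :: "complex \<Rightarrow> 'k" where "cK \<equiv> of_complex_K \<iota>"

lemma cK_add: "cK (a + b) = cK a + cK b"
  by (simp only: of_complex_K_def fls_plus_const[symmetric] to_ac_add hom_add)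

lemma cK_mult: "cK (a * b) = cK a * cK b"
  by (simp only: of_complex_K_def fls_const_mult_const[symmetric] to_ac_mult hom_mult)

lemma cK_0 [simp]: "cK 0 = 0"
  using cK_add[of 0 0] by (metis add_cancel_right_right add_0)

lemma cK_1 [simp]: "cK 1 = 1"
  by (simp add: of_complex_K_def hom_one)

text \<open>A nonzero constant series has subdegree 0, which gives \<open>exp 0\<close>.\<close>

lemma absval_cK: "c \<noteq> 0 \<Longrightarrow> absval (cK c) = 1"
  by (simp add: of_complex_K_def absval_fls)

lemma absval_cK_le: "absval (cK c) \<le> 1"
  by (cases "c = 0") (auto simp: absval_cK)

end

section \<open>Evaluation of Laurent series at infinity\<close>

text \<open>With a common radius \<open>r\<close>, the absolute value of a monomial depends only on
  its total degree. The locale is interpreted at the base point and at a hypothetical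
  solution.\<close>

locale evaluation_point = completed_alg_closure \<iota>
  for \<iota> :: "complex fls alg_closure \<Rightarrow> 'k::{field,complete_space}" +
  fixes x y :: 'k and r :: real
  assumes absval_x: "absval x = r" and absval_y: "absval y = r" and r_gt_1: "1 < r"
begin

section \<open>Evaluation of Laurent polynomials\<close>

lemma x_nz [simp]: "x \<noteq> 0" and y_nz [simp]: "y \<noteq> 0"
  using absval_x absval_y r_gt_1 by auto

abbreviation ev where "ev p \<equiv> eval_lpoly2 \<iota> p x y"

lemma ev_superset:
  assumes "finite S" "Poly_Mapping.keys p \<subseteq> S"
  shows "ev p = (\<Sum>(a, b)\<in>S. cK (Poly_Mapping.lookup p (a, b)) * x powi a * y powi b)"
  unfolding eval_lpoly2_def
  by (rule sum.mono_neutral_left) (use assms in \<open>auto simp: in_keys_iff\<close>)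

lemma ev_0 [simp]: "ev 0 = 0"
  by (simp add: eval_lpoly2_def)

lemma ev_add: "ev (p + q) = ev p + ev q"
proof -
  let ?S = "Poly_Mapping.keys p \<union> Poly_Mapping.keys q"
  have "ev (p + q) = (\<Sum>(a, b)\<in>?S. cK (Poly_Mapping.lookup (p + q) (a, b)) * x powi a * y powi b)"
    by (rule ev_superset) (use keys_add[of p q] in auto)
  also have "\<dots> = (\<Sum>(a, b)\<in>?S. cK (Poly_Mapping.lookup p (a, b)) * x powi a * y powi b) +
      (\<Sum>(a, b)\<in>?S. cK (Poly_Mapping.lookup q (a, b)) * x powi a * y powi b)"
    by (simp add: lookup_add cK_add distrib_right case_prod_unfold flip: sum.distrib)
  also have "\<dots> = ev p + ev q"
    by (simp add: ev_superset[of ?S p] ev_superset[of ?S q])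
  finally show ?thesis .
qed

lemma ev_sum: "ev (sum f A) = (\<Sum>a\<in>A. ev (f a))"
  by (induction A rule: infinite_finite_induct) (auto simp: ev_add)

lemma ev_single: "ev (Poly_Mapping.single (a, b) c) = cK c * x powi a * y powi b"
  by (simp add: eval_lpoly2_def)

text \<open>By additivity it suffices to treat products of single terms, where the power law holds
  because \<open>x\<close> and \<open>y\<close> are nonzero.\<close>

lemma ev_mult: "ev (p * q) = ev p * ev q"
proof -
  let ?t = "\<lambda>p. \<Sum>k\<in>Poly_Mapping.keys p. Poly_Mapping.single k (Poly_Mapping.lookup p k)"
  have expand: "?t p = p" for p :: lpoly2
    by (rule poly_mapping_eqI) (simp add: lookup_sum lookup_single when_def in_keys_iff)
  have single: "ev (Poly_Mapping.single k c * Poly_Mapping.single l c') =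
      ev (Poly_Mapping.single k c) * ev (Poly_Mapping.single l c')" for k l c c'
    by (cases k; cases l) (simp add: mult_single ev_single cK_mult power_int_add algebra_simps)
  have "ev (?t p * ?t q) = ev (?t p) * ev (?t q)"
    by (simp add: sum_product ev_sum single)
  then show ?thesis by (simp only: expand)
qed

text \<open>Each term is at most \<open>r powi a * r powi b = r powi i\<close>, and the ultrametric
  inequality carries this bound to the sum.\<close>

lemma absval_ev_homogeneous:
  assumes "homogeneous i p"
  shows "absval (ev p) \<le> r powi i"
  unfolding eval_lpoly2_def
proof (rule absval_sum_le)
  fix k assume k: "k \<in> Poly_Mapping.keys p"
  obtain a b where ab: "k = (a, b)" by (cases k)
  then have "a + b = i" using assms k by (auto simp: homogeneous_def)
  then have "r powi a * r powi b = r powi i"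
    using r_gt_1 power_int_add[of r a b] by simp
  moreover have "absval (cK (Poly_Mapping.lookup p (a, b))) * (r powi a * r powi b)
      \<le> 1 * (r powi a * r powi b)"
    using r_gt_1 absval_cK_le by (intro mult_right_mono) auto
  ultimately show "absval (case k of (a, b) \<Rightarrow>
      cK (Poly_Mapping.lookup p (a, b)) * x powi a * y powi b) \<le> r powi i"
    by (simp add: ab absval_mult absval_powi absval_x absval_y mult.assoc)
qed (use r_gt_1 in simp)

section \<open>Convergence of the evaluation of series\<close>

abbreviation EV where "EV F \<equiv> eval_inf \<iota> F x y"

text \<open>The exponent \<open>M + n\<close> of \<open>s\<close> carries degree
  \<open>- M - n\<close>; the bound is geometric in \<open>n\<close> with ratio
  \<open>1 / r < 1\<close>.\<close>

lemma absval_ev_nth: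
  assumes "F \<in> CL_inf"
  shows "absval (ev (fls_nth F (M + int n))) \<le> r powi (- M) * (1 / r) ^ n"
  using absval_ev_homogeneous[OF CL_inf_nth[OF assms, of "M + int n"]] r_gt_1
  by (simp add: power_int_diff power_one_over field_simps)

lemma powi_decreasing:
  assumes "N \<le> n"
  shows "r powi (- M) * (1 / r) ^ n \<le> r powi (- M) * (1 / r) ^ N"
  using r_gt_1 assms by (intro mult_left_mono power_decreasing) auto

lemma bound_tendsto_0: "(\<lambda>n. r powi (- M) * (1 / r) ^ n) \<longlonglongrightarrow> 0"
  using r_gt_1 by (intro tendsto_mult_right_zero LIMSEQ_realpow_zero) auto

text \<open>The difference of two partial sums is bounded by the bound for its first term, so the
  partial sums are Cauchy and completeness applies.\<close>

lemma summable_ev_nth: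
  assumes "F \<in> CL_inf"
  shows "summable (\<lambda>n. ev (fls_nth F (M + int n)))"
proof -
  let ?a = "\<lambda>n. ev (fls_nth F (M + int n))"
  let ?S = "\<lambda>N. \<Sum>n<N. ?a n"
  let ?B = "\<lambda>n. r powi (- M) * (1 / r) ^ n"
  have dist: "dist (?S p) (?S q) \<le> ?B N" if "N \<le> p" "p \<le> q" for N p q
  proof -
    have "?S q - ?S p = (\<Sum>n\<in>{p..<q}. ?a n)"
      using that by (simp add: lessThan_atLeast0 sum_diff_nat_ivl)
    also have "absval \<dots> \<le> ?B N"
    proof (rule absval_sum_le)
      fix n assume "n \<in> {p..<q}"
      then show "absval (?a n) \<le> ?B N"
        using absval_ev_nth[OF assms, of M n] powi_decreasing[of N n M] that by auto
    qed (use r_gt_1 in simp)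
    finally have "dist (?S q) (?S p) \<le> ?B N" by (simp only: dist_absval)
    then show ?thesis by (simp only: dist_commute)
  qed
  have "Cauchy ?S"
  proof (rule metric_CauchyI)
    fix e :: real assume "0 < e"
    then obtain N where N: "?B N < e"
      using order_tendstoD(2)[OF bound_tendsto_0[of M], of e] eventually_sequentially by auto
    have "dist (?S p) (?S q) < e" if "N \<le> p" "N \<le> q" for p q
      using dist[of N p q] dist[of N q p] that N by (cases "p \<le> q") (auto simp: dist_commute)
    then show "\<exists>N. \<forall>p\<ge>N. \<forall>q\<ge>N. dist (?S p) (?S q) < e" by blast
  qed
  then show ?thesis
    by (auto simp: summable_def sums_def convergent_def dest: Cauchy_convergent)
qed

text \<open>\<open>eval_inf\<close> starts at the subdegree, which can jump when leading terms
  cancel in a sum. Any start \<open>M\<close> below which \<open>F\<close> vanishes yields the same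
  value, so several series can share one start.\<close>

lemma sums_EV:
  assumes F: "F \<in> CL_inf" and zero: "\<And>n. n < M \<Longrightarrow> fls_nth F n = 0"
  shows "(\<lambda>n. ev (fls_nth F (M + int n))) sums EV F"
proof (cases "F = 0")
  case True
  then show ?thesis by (simp add: eval_inf_def)
next
  case False
  \<comment> \<open>This counts the zero terms placed in front; \<open>nat\<close> truncates
    nothing, since \<open>M\<close> is at most the subdegree.\<close>
  define d where "d = nat (fls_subdegree F - M)"
  have d: "fls_subdegree F = M + int d"
    using fls_subdegree_geI[OF False, of M] zero by (simp add: d_def)
  let ?a = "\<lambda>n. ev (fls_nth F (M + int n))"
  have a: "ev (fls_nth F (fls_subdegree F + int n)) = ?a (n + d)" for n
    by (simp add: d add_ac)
  have "(\<lambda>n. ?a (n + d)) sums EV F"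
    unfolding eval_inf_def a[symmetric] by (rule summable_sums[OF summable_ev_nth[OF F]])
  moreover have "(\<Sum>n<N. ?a (n + d)) = (\<Sum>n<N + d. ?a n)" for N
  proof -
    have "(\<Sum>n<d. ?a n) = 0"
      by (rule sum.neutral) (auto simp: d intro: fls_eq0_below_subdegree)
    then show ?thesis by (induction N) auto
  qed
  ultimately show ?thesis
    unfolding sums_def by (auto intro: LIMSEQ_offset)
qed

lemma EV_unique:
  assumes "F \<in> CL_inf" "\<And>n. n < M \<Longrightarrow> fls_nth F n = 0"
    and "(\<lambda>n. ev (fls_nth F (M + int n))) sums L"
  shows "EV F = L"
  using sums_unique2 sums_EV assms by blast

lemma absval_EV_le:
  assumes F: "F \<in> CL_inf" and zero: "\<And>n. n < M \<Longrightarrow> fls_nth F n = 0"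
  shows "absval (EV F) \<le> r powi (- M)"
proof (rule absval_limit_le[OF sums_EV[OF assms, unfolded sums_def]])
  fix N
  show "absval (\<Sum>n<N. ev (fls_nth F (M + int n))) \<le> r powi (- M)"
  proof (rule absval_sum_le)
    fix n show "absval (ev (fls_nth F (M + int n))) \<le> r powi (- M)"
      using absval_ev_nth[OF F, of M n] powi_decreasing[of 0 n M] by simp
  qed (use r_gt_1 in auto)
qed

section \<open>Evaluation as a ring homomorphism on \<open>CL_inf\<close>\<close>

lemma EV_add:
  assumes "F \<in> CL_inf" "G \<in> CL_inf"
  shows "EV (F + G) = EV F + EV G"
proof -
  define M where "M = min (fls_subdegree F) (fls_subdegree G)"
  have 0: "fls_nth F n = 0" "fls_nth G n = 0" if "n < M" for n
    using that by (auto simp: M_def intro: fls_eq0_below_subdegree)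
  show ?thesis
  proof (rule EV_unique[of _ M])
    show "(\<lambda>n. ev (fls_nth (F + G) (M + int n))) sums (EV F + EV G)"
      using tendsto_add_absval[OF sums_EV[OF assms(1) 0(1), unfolded sums_def]
          sums_EV[OF assms(2) 0(2), unfolded sums_def]]
      by (simp add: sums_def ev_add sum.distrib)
  qed (simp_all add: CL_inf_add assms 0)
qed

lemma EV_monom: "EV (monom_inf c a b) = cK c * x powi a * y powi b"
proof (rule EV_unique[of _ "- (a + b)"])
  have "fls_nth (monom_inf c a b) (- (a + b) + int n) =
      (if n = 0 then Poly_Mapping.single (a, b) c else 0)" for n
    by (simp add: monom_inf_def)
  then have "(\<lambda>n. ev (fls_nth (monom_inf c a b) (- (a + b) + int n))) =
      (\<lambda>n. if n = 0 then cK c * x powi a * y powi b else 0)"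
    by (auto simp: ev_single)
  also have "\<dots> sums (cK c * x powi a * y powi b)"
    using sums_finite[of "{0 :: nat}" "\<lambda>n. if n = 0 then cK c * x powi a * y powi b else 0"] by simp
  finally show "(\<lambda>n. ev (fls_nth (monom_inf c a b) (- (a + b) + int n))) sums
      (cK c * x powi a * y powi b)" .
qed (simp, simp add: monom_inf_def)

lemma EV_0 [simp]: "EV 0 = 0"
  by (simp add: eval_inf_def)

lemma EV_const: "EV (const_inf c) = cK c"
  by (simp add: EV_monom)

lemma EV_1 [simp]: "EV 1 = 1"
  using EV_const[of 1] by (simp only: const_inf_1 cK_1)

lemma EV_sum: "(\<And>a. a \<in> A \<Longrightarrow> f a \<in> CL_inf) \<Longrightarrow> EV (sum f A) = (\<Sum>a\<in>A. EV (f a))"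
  by (induction A rule: infinite_finite_induct) (auto simp: EV_add CL_inf_sum)

lemma EV_diff:
  assumes "F \<in> CL_inf" "G \<in> CL_inf"
  shows "EV (F - G) = EV F - EV G"
  using EV_add[OF CL_inf_diff[OF assms] assms(2)] by (simp add: algebra_simps)

text \<open>Counting from the subdegrees turns the convolution over integers into a Cauchy product
  over naturals, as the triangular reindexing in \<open>EV_mult\<close> requires.\<close>

lemma fls_times_nth_nat:
  fixes F G :: series_inf
  shows "fls_nth (F * G) (fls_subdegree F + fls_subdegree G + int n) =
    (\<Sum>i\<le>n. fls_nth F (fls_subdegree F + int i) * fls_nth G (fls_subdegree G + int (n - i)))"
proof -
  have "{0..int n} = int ` {..n}"
    by (simp add: image_int_atLeastAtMost atMost_atLeast0)
  then show ?thesis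
    by (simp add: fls_times_nth(4) sum.reindex of_nat_diff algebra_simps)
qed

text \<open>A partial sum for the product runs over the triangle \<open>i + j < N\<close>, the
  product of partial sums over the square. Each term in between has \<open>N \<le> i + j\<close>,
  hence is at most \<open>?B N\<close>; by the ultrametric inequality so is the whole difference,
  which tends to 0.\<close>

lemma EV_mult:
  assumes F: "F \<in> CL_inf" and G: "G \<in> CL_inf"
  shows "EV (F * G) = EV F * EV G"
proof -
  let ?M = "fls_subdegree F" and ?M' = "fls_subdegree G"
  let ?f = "\<lambda>n. ev (fls_nth F (?M + int n))" and ?g = "\<lambda>n. ev (fls_nth G (?M' + int n))"
  let ?S = "\<lambda>N. (\<Sum>i<N. ?f i) * (\<Sum>j<N. ?g j)"
  let ?P = "\<lambda>N. \<Sum>n<N. ev (fls_nth (F * G) (?M + ?M' + int n))"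
  let ?B = "\<lambda>n. r powi (- (?M + ?M')) * (1 / r) ^ n"
  have S: "?S \<longlonglongrightarrow> EV F * EV G"
    using sums_EV[OF F, of ?M] sums_EV[OF G, of ?M']
    by (intro tendsto_mult_absval) (auto simp: sums_def fls_eq0_below_subdegree)
  have le: "absval (?P N - ?S N) \<le> ?B N" for N
  proof -
    have "?P N = (\<Sum>n<N. \<Sum>i\<le>n. ?f i * ?g (n - i))"
      by (simp only: fls_times_nth_nat ev_sum ev_mult)
    also have "\<dots> = (\<Sum>(i, j)\<in>{(i, j). i + j < N}. ?f i * ?g j)"
      by (rule sum.triangle_reindex[symmetric])
    finally have P: "?P N = \<dots>" .
    have S: "?S N = (\<Sum>(i, j)\<in>{..<N} \<times> {..<N}. ?f i * ?g j)"
      by (simp add: sum_product sum.cartesian_product)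
    have sub: "{(i, j). i + j < N} \<subseteq> {..<N} \<times> {..<N}" by auto
    have "?S N - ?P N = (\<Sum>(i, j)\<in>{..<N} \<times> {..<N} - {(i, j). i + j < N}. ?f i * ?g j)"
      unfolding S P by (subst sum_diff[OF _ sub]) auto
    also have "absval \<dots> \<le> ?B N"
    proof (rule absval_sum_le)
      fix k assume "k \<in> {..<N} \<times> {..<N} - {(i, j). i + j < N}"
      then obtain i j where k: "k = (i, j)" "N \<le> i + j" by auto
      have "absval (?f i) * absval (?g j) \<le>
          (r powi (- ?M) * (1 / r) ^ i) * (r powi (- ?M') * (1 / r) ^ j)"
        using absval_ev_nth[OF F, of ?M i] absval_ev_nth[OF G, of ?M' j] r_gt_1
        by (intro mult_mono) (auto simp: absval_nonneg)
      also have "\<dots> = (r powi (- ?M) * r powi (- ?M')) * ((1 / r) ^ i * (1 / r) ^ j)"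
        by (simp only: mult_ac)
      also have "\<dots> = ?B (i + j)"
        using r_gt_1 power_int_add[of r "- ?M" "- ?M'"] power_add[of "1 / r" i j] by simp
      also have "\<dots> \<le> ?B N" by (rule powi_decreasing[OF k(2)])
      finally show "absval (case k of (i, j) \<Rightarrow> ?f i * ?g j) \<le> ?B N"
        by (simp add: k absval_mult)
    qed (use r_gt_1 in simp)
    finally show ?thesis using absval_minus[of "?S N - ?P N"] by simp
  qed
  have "(\<lambda>N. dist (?P N - ?S N) 0) \<longlonglongrightarrow> 0"
    by (rule tendsto_sandwich[OF _ _ tendsto_const bound_tendsto_0[of "?M + ?M'"]];
        intro always_eventually allI zero_le_dist le[unfolded absval_def])
  then have "(\<lambda>N. ?P N - ?S N) \<longlonglongrightarrow> 0"
    by (rule tendsto_dist_iff[THEN iffD2])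
  from tendsto_add_absval[OF this S] have "?P \<longlonglongrightarrow> EV F * EV G" by simp
  then show ?thesis
    by (intro EV_unique[of _ "?M + ?M'"]) (auto simp: sums_def F G CL_inf_mult fls_times_nth_eq0)
qed

lemma EV_power: "F \<in> CL_inf \<Longrightarrow> EV (F ^ n) = EV F ^ n"
  by (induction n) (auto simp: EV_mult CL_inf_power)

lemma EV_powi:
  assumes "inverses_in_CL_inf H H'"
  shows "EV (powi_inf H i) = EV H powi i"
proof -
  have H: "H \<in> CL_inf" "H' \<in> CL_inf" "H * H' = 1"
    using assms by (auto simp: inverses_in_CL_inf_def)
  have "EV H * EV H' = 1" using EV_mult[OF H(1,2)] H(3) by simp
  then have "EV H' = inverse (EV H)" by (simp add: inverse_unique)
  then show ?thesis
    using H by (simp add: powi_inf_inverses[OF assms] EV_power power_int_def)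
qed

text \<open>The value depends on \<open>H\<close> only through \<open>EV H\<close>. Hence different
  series that take the same value at different points give the same value of
  \<open>W\<close>.\<close>

lemma EV_lpoly_subst:
  assumes "inverses_in_CL_inf H H'"
  shows "EV (lpoly_subst W H) =
    (\<Sum>i\<in>Poly_Mapping.keys W. cK (Poly_Mapping.lookup W i) * EV H powi i)"
  unfolding lpoly_subst_def
  by (simp add: EV_sum EV_mult CL_inf_mult CL_inf_powi[OF assms] EV_powi[OF assms] EV_const)

text \<open>All other terms together are strictly smaller than the leading monomial, so it alone
  determines the absolute value.\<close>

lemma absval_EV_leading:
  assumes "leading_tld F c a b" "c \<noteq> 0"
  shows "absval (EV F) = r powi (a + b)"
proof -
  obtain R where R: "R \<in> CL_inf" "F = monom_inf c a b + R" "\<And>n. n \<le> - (a + b) \<Longrightarrow> fls_nth R n = 0"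
    using leading_tldE[OF assms(1)] by blast
  have lead: "absval (EV (monom_inf c a b)) = r powi (a + b)"
    using r_gt_1 assms(2)
    by (simp add: EV_monom absval_mult absval_powi absval_cK absval_x absval_y power_int_add)
  \<comment> \<open>The remainder starts at the exponent \<open>1 - (a + b)\<close> of
    \<open>s\<close>, that is, one degree below the leading monomial.\<close>
  have "absval (EV R) \<le> r powi (- (1 - (a + b)))"
    by (rule absval_EV_le) (auto simp: R)
  also have "\<dots> < r powi (a + b)"
    using r_gt_1 by (intro power_int_strict_increasing) auto
  finally show ?thesis
    using absval_add_eq_left lead by (simp add: R EV_add)
qed

end

theorem proposition3:
  fixes \<iota> :: "complex fls alg_closure \<Rightarrow> 'k::{field,complete_space}"
    and f g :: "complex poly poly"
    and n1 n2 m1 m2 n m k :: nat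
    and c1 d e \<epsilon>0 \<epsilon> :: complex
    and h :: series_inf
    and W :: "int \<Rightarrow>\<^sub>0 complex"
    and n1' n2' :: int
    and \<delta> \<rho> r :: real
    and V :: "('k \<times> 'k) set"
    and x0 y0 \<alpha>0 \<beta>0 :: 'k
  assumes K: "completed_alg_closure \<iota>"
    and jac: "jacobian_det f g = 1"
    and not_aut: "\<not> polynomial_automorphism f g"
    and pos: "0 < n1" "0 < n2" "0 < m1" "0 < m2"
    and lead_g: "leading_tld (of_poly2 g) 1 (int n1) (int n2)"
    and lead_f: "c1 \<noteq> 0" "leading_tld (of_poly2 f) c1 (int m1) (int m2)"
    and n_def: "n = n1 + n2"
    and m_def: "m = m1 + m2"
    and k_def: "k = gcd n1 n2"
    and ratio: "real m1 / real n1 = real m2 / real n2"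
    and mn: "m \<noteq> n"
    and h_def: "h = root_inf k (int n1) (int n2) (of_poly2 g)"
    and cond1: "n1 \<noteq> n2"
    and cond2: "1 < k" "d \<noteq> 0"
      "leading_tld (of_poly2 f - lpoly_subst W h) d (1 - int n1) (1 - int n2)"
    and cond3: "\<epsilon>0 ^ k = 1" "e \<noteq> 0"
      "leading_tld (of_poly2 f - lpoly_subst W (const_inf \<epsilon>0 * h)) e n1' n2'"
      "n1' + n2' > 2 - int n"
    and radii: "1 < \<delta>" "\<delta> \<le> \<rho>"
    and V_def: "V = {(x, y). \<delta> \<le> absval x \<and> absval x = absval y \<and> absval y \<le> \<rho>}"
    and point: "(x0, y0) \<in> V"
    and r_def: "r = absval x0"
    and \<alpha>0_def: "\<alpha>0 = eval_inf \<iota> (of_poly2 f) x0 y0"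
    and \<beta>0_def: "\<beta>0 = eval_inf \<iota> h x0 y0"
    and prim: "primitive_root_of_unity k \<epsilon>"
  shows "\<exists>i\<in>{1..k - 1}.
    \<not> (\<exists>x y. absval x = r \<and> absval y = r \<and>
          eval_inf \<iota> (of_poly2 f) x y = \<alpha>0 \<and>
          eval_inf \<iota> (const_inf (\<epsilon> ^ i) * h) x y = \<beta>0)"
proof -
  have r: "absval x0 = r" "absval y0 = r" "1 < r"
    using point radii by (auto simp: V_def r_def)
  have F: "of_poly2 f \<in> CL_inf" by (rule CL_inf_of_poly2)
  obtain h' where h: "inverses_in_CL_inf h h'"
    using root_inf_unit[OF lead_g] h_def by blast
  have hC: "h \<in> CL_inf" using h by (simp add: inverses_in_CL_inf_def)
  have "0 < k" using cond2(1) by simp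
  have "\<epsilon>0 \<noteq> 0" using cond3(1) \<open>0 < k\<close> by (auto simp: power_0_left)
  have h0: "inverses_in_CL_inf (const_inf \<epsilon>0 * h) (const_inf (1 / \<epsilon>0) * h')"
    by (rule inverses_const_mult[OF h \<open>\<epsilon>0 \<noteq> 0\<close>])
  \<comment> \<open>The left exponent is \<open>2 - n\<close>, and powers of \<open>r > 1\<close>
    increase strictly with the exponent.\<close>
  have radius_ne: "r powi (1 - int n1 + (1 - int n2)) \<noteq> r powi (n1' + n2')"
    using r(3) cond3(4) n_def power_int_strict_increasing[of "1 - int n1 + (1 - int n2)" "n1' + n2'" r]
    by simp
  interpret p0: evaluation_point \<iota> x0 y0 r
    by (intro evaluation_point.intro evaluation_point_axioms.intro K r)
  have lead0: "absval (p0.EV (of_poly2 f - lpoly_subst W h)) = r powi (1 - int n1 + (1 - int n2))"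
    by (rule p0.absval_EV_leading[OF cond2(3,2)])
  \<comment> \<open>Otherwise both differences would be the same series, with two different absolute
    values at the base point.\<close>
  have "\<epsilon>0 \<noteq> 1"
  proof
    assume "\<epsilon>0 = 1"
    then have "absval (p0.EV (of_poly2 f - lpoly_subst W h)) = r powi (n1' + n2')"
      using p0.absval_EV_leading[OF cond3(3,2)] by (simp add: const_inf_1)
    with lead0 radius_ne show False by simp
  qed
  obtain i where i: "i < k" "\<epsilon> ^ i = \<epsilon>0"
    using primitive_root_generates[OF prim \<open>0 < k\<close> cond3(1)] by blast
  have "i \<noteq> 0" using i(2) \<open>\<epsilon>0 \<noteq> 1\<close> by (auto intro: ccontr)
  then have "i \<in> {1..k - 1}" using i(1) by auto
  moreover have False
    if sol: "absval x = r" "absval y = r" "eval_inf \<iota> (of_poly2 f) x y = \<alpha>0"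
      "eval_inf \<iota> (const_inf (\<epsilon> ^ i) * h) x y = \<beta>0" for x y
  proof -
    interpret p: evaluation_point \<iota> x y r
      by (intro evaluation_point.intro evaluation_point_axioms.intro K sol r)
    \<comment> \<open>This is \<open>W(\<beta>0)\<close>, shared by both points: \<open>h\<close>
      has the value \<open>\<beta>0\<close> at the base point, and \<open>\<epsilon>0 h\<close> has
      it at the solution.\<close>
    let ?w = "\<Sum>j\<in>Poly_Mapping.keys W. of_complex_K \<iota> (Poly_Mapping.lookup W j) * \<beta>0 powi j"
    have "p0.EV (of_poly2 f - lpoly_subst W h) = \<alpha>0 - ?w"
      by (simp add: p0.EV_diff F CL_inf_lpoly_subst[OF h] p0.EV_lpoly_subst[OF h] \<alpha>0_def \<beta>0_def)
    moreover have "p.EV (of_poly2 f - lpoly_subst W (const_inf \<epsilon>0 * h)) = \<alpha>0 - ?w"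
      using sol(3,4)
      by (simp add: p.EV_diff F CL_inf_lpoly_subst[OF h0] p.EV_lpoly_subst[OF h0] i(2))
    ultimately show False
      using lead0 radius_ne p.absval_EV_leading[OF cond3(3,2)] by simp
  qed
  ultimately show ?thesis by blast
qed

end
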